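(* Let $(A,L,\omega)$ and $(A',L',\omega')$ be Lie-Rinehart algebras over commutative $\Bbbk$-algebras $A$ and $A'$ respectively. The datum of a morphism of Lie-Rinehart algebras from $(A,L,\omega)$ to $(A',L',\omega')$ in the sense (i) below is equivalent to the datum of a morphism in the sense (ii) (Huebschmann's definition): (i) a pair $(\phi,\Phi)$ where $\phi:A\to A'$ is a morphism of commutative $\Bbbk$-algebras and $\Phi:L\to\mathcal{A}_A^{A'}(L',\omega')$ is a morphism of Lie-Rinehart algebras over $A$; (ii) a pair $(\phi,\psi)$ where $\phi:A\to A'$ is a morphism of $\Bbbk$-algebras and $\psi:L\to L'$ is a morphism of Lie algebras and of left $A$-modules such that $\phi(\omega(X)(a))=\omega'(\psi(X))(\phi(a))$ for all $a\in A$, $X\in L$.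
   Context: $\Bbbk$ is a field of characteristic $0$. A Lie-Rinehart algebra $(A,L,\omega)$ over a commutative $\Bbbk$-algebra $A$ is a $\Bbbk$-Lie algebra $L$ with a left $A$-module structure and a Lie algebra morphism $\omega:L\to\mathrm{Der}_\Bbbk(A)$ (the anchor) such that $\omega(a\cdot X)=a\cdot\omega(X)$ and $[X,a\cdot Y]=a\cdot[X,Y]+\omega(X)(a)\cdot Y$ for all $a\in A$, $X,Y\in L$. A morphism of Lie-Rinehart algebras over $A$ from $(L,\omega)$ to $(L_1,\omega_1)$ is an $A$-linear Lie algebra morphism $f$ with $\omega_1\circ f=\omega$. Given a morphism of commutative $\Bbbk$-algebras $\phi:A\to A'$ and a Lie-Rinehart algebra $(A',L',\omega')$, $L'$ is regarded as a left $A$-module via $\phi$, and $$\mathcal{A}_A^{A'}(L',\omega')=\{(X,\delta)\in L'\times\mathrm{Der}_\Bbbk(A)\mid\omega'(X)(\phi(a))=\phi(\delta(a))\ \forall a\in A\},$$ which is a Lie-Rinehart algebra over $A$ with component-wise bracket, action $a\cdot(X,\delta)=(\phi(a)\cdot X,a\cdot\delta)$ and anchor $(X,\delta)\mapsto\delta$. *)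

theory Defs
  imports "HOL-Algebra.Module"
begin

locale field_char0 = field K for K (structure) +
  assumes char0: "n > 0 \<Longrightarrow> [(n::nat)] \<cdot> \<one> \<noteq> \<zero>"

definition alg_hom ::
  "('k, 'm) ring_scheme \<Rightarrow> ('k, 'a, 'n) module_scheme \<Rightarrow> ('k, 'b, 'p) module_scheme \<Rightarrow> ('a \<Rightarrow> 'b) set"
  where "alg_hom K A B =
    {f \<in> ring_hom A B. \<forall>c \<in> carrier K. \<forall>a \<in> carrier A. f (c \<odot>\<^bsub>A\<^esub> a) = c \<odot>\<^bsub>B\<^esub> f a}"

text \<open>
  The underlying \<open>K\<close>-module of a Lie algebra uses the module record of the library; its
  slots for multiplication and unit carry no information and are not used.
\<close>

record ('k, 'l) lie_alg = "('k, 'l) module" +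
  bracket :: "'l \<Rightarrow> 'l \<Rightarrow> 'l"

locale lie_algebra = module K L for K and L :: "('k, 'l, 'm) lie_alg_scheme" (structure) +
  assumes bracket_closed:
      "\<lbrakk>x \<in> carrier L; y \<in> carrier L\<rbrakk> \<Longrightarrow> bracket L x y \<in> carrier L"
    and bracket_add_left:
      "\<lbrakk>x \<in> carrier L; y \<in> carrier L; z \<in> carrier L\<rbrakk> \<Longrightarrow>
        bracket L (x \<oplus> y) z = bracket L x z \<oplus> bracket L y z"
    and bracket_add_right:
      "\<lbrakk>x \<in> carrier L; y \<in> carrier L; z \<in> carrier L\<rbrakk> \<Longrightarrow>
        bracket L x (y \<oplus> z) = bracket L x y \<oplus> bracket L x z"
    and bracket_smult_left:
      "\<lbrakk>c \<in> carrier K; x \<in> carrier L; y \<in> carrier L\<rbrakk> \<Longrightarrow>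
        bracket L (c \<odot> x) y = c \<odot> bracket L x y"
    and bracket_smult_right:
      "\<lbrakk>c \<in> carrier K; x \<in> carrier L; y \<in> carrier L\<rbrakk> \<Longrightarrow>
        bracket L x (c \<odot> y) = c \<odot> bracket L x y"
    and bracket_self: "x \<in> carrier L \<Longrightarrow> bracket L x x = \<zero>"
    and jacobi:
      "\<lbrakk>x \<in> carrier L; y \<in> carrier L; z \<in> carrier L\<rbrakk> \<Longrightarrow>
        bracket L x (bracket L y z) \<oplus> bracket L y (bracket L z x)
          \<oplus> bracket L z (bracket L x y) = \<zero>"

definition lie_hom ::
  "('k, 'm) ring_scheme \<Rightarrow> ('k, 'l, 'n) lie_alg_scheme \<Rightarrow> ('k, 'h, 'p) lie_alg_scheme \<Rightarrow> ('l \<Rightarrow> 'h) set"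
  where "lie_hom K L M =
    {f \<in> carrier L \<rightarrow> carrier M.
      (\<forall>x \<in> carrier L. \<forall>y \<in> carrier L. f (x \<oplus>\<^bsub>L\<^esub> y) = f x \<oplus>\<^bsub>M\<^esub> f y) \<and>
      (\<forall>c \<in> carrier K. \<forall>x \<in> carrier L. f (c \<odot>\<^bsub>L\<^esub> x) = c \<odot>\<^bsub>M\<^esub> f x) \<and>
      (\<forall>x \<in> carrier L. \<forall>y \<in> carrier L. f (bracket L x y) = bracket M (f x) (f y))}"

record ('k, 'a, 'l) lie_rinehart_alg = "('k, 'l) lie_alg" +
  act :: "'a \<Rightarrow> 'l \<Rightarrow> 'l"
  anchor :: "'l \<Rightarrow> 'a \<Rightarrow> 'a"

text \<open>The additive group of \<open>L\<close>, with \<open>A\<close> instead of \<open>K\<close> as the ring of scalars.\<close>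

definition act_module :: "('k, 'a, 'l, 'm) lie_rinehart_alg_scheme \<Rightarrow> ('a, 'l) module"
  where "act_module L =
    \<lparr>carrier = carrier L, mult = mult L, one = one L, zero = zero L, add = add L, smult = act L\<rparr>"

text \<open>
  The derivations of \<open>A\<close> over \<open>K\<close>. They are required to be extensional, so that two
  derivations are equal as soon as they agree on the carrier of \<open>A\<close>.
\<close>

definition derivations ::
  "('k, 'm) ring_scheme \<Rightarrow> ('k, 'a, 'n) module_scheme \<Rightarrow> ('k, 'a, 'a \<Rightarrow> 'a) lie_rinehart_alg"
  where "derivations K A =
    \<lparr>carrier = {d \<in> carrier A \<rightarrow>\<^sub>E carrier A.
        (\<forall>a \<in> carrier A. \<forall>b \<in> carrier A. d (a \<oplus>\<^bsub>A\<^esub> b) = d a \<oplus>\<^bsub>A\<^esub> d b) \<and>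
        (\<forall>c \<in> carrier K. \<forall>a \<in> carrier A. d (c \<odot>\<^bsub>A\<^esub> a) = c \<odot>\<^bsub>A\<^esub> d a) \<and>
        (\<forall>a \<in> carrier A. \<forall>b \<in> carrier A.
          d (a \<otimes>\<^bsub>A\<^esub> b) = d a \<otimes>\<^bsub>A\<^esub> b \<oplus>\<^bsub>A\<^esub> a \<otimes>\<^bsub>A\<^esub> d b)},
      mult = undefined, one = undefined,
      zero = (\<lambda>a \<in> carrier A. \<zero>\<^bsub>A\<^esub>),
      add = (\<lambda>d e. \<lambda>a \<in> carrier A. d a \<oplus>\<^bsub>A\<^esub> e a),
      smult = (\<lambda>c d. \<lambda>a \<in> carrier A. c \<odot>\<^bsub>A\<^esub> d a),
      bracket = (\<lambda>d e. \<lambda>a \<in> carrier A. d (e a) \<ominus>\<^bsub>A\<^esub> e (d a)),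
      act = (\<lambda>b d. \<lambda>a \<in> carrier A. b \<otimes>\<^bsub>A\<^esub> d a),
      anchor = (\<lambda>d. d)\<rparr>"

text \<open>
  \<open>smult_act\<close> says that the scalar action of \<open>K\<close> on \<open>L\<close> is the one induced from the
  action of the \<open>K\<close>-algebra \<open>A\<close>.
\<close>

locale lie_rinehart =
  A: algebra K A + L: lie_algebra K L + act: module A "act_module L"
  for K and A :: "('k, 'a, 'n) module_scheme"
    and L :: "('k, 'a, 'l, 'm) lie_rinehart_alg_scheme" +
  assumes smult_act:
      "\<lbrakk>c \<in> carrier K; a \<in> carrier A; x \<in> carrier L\<rbrakk> \<Longrightarrow>
        act L (c \<odot>\<^bsub>A\<^esub> a) x = c \<odot>\<^bsub>L\<^esub> act L a x"
    and anchor_hom: "anchor L \<in> lie_hom K L (derivations K A)"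
    and anchor_act:
      "\<lbrakk>a \<in> carrier A; x \<in> carrier L\<rbrakk> \<Longrightarrow>
        anchor L (act L a x) = act (derivations K A) a (anchor L x)"
    and bracket_act:
      "\<lbrakk>a \<in> carrier A; x \<in> carrier L; y \<in> carrier L\<rbrakk> \<Longrightarrow>
        bracket L x (act L a y) = act L a (bracket L x y) \<oplus>\<^bsub>L\<^esub> act L (anchor L x a) y"

text \<open>Morphisms of Lie-Rinehart algebras over one and the same \<open>A\<close>.\<close>

definition lie_rinehart_hom ::
  "('k, 'm) ring_scheme \<Rightarrow> ('k, 'a, 'n) module_scheme \<Rightarrow> ('k, 'a, 'l, 'p) lie_rinehart_alg_scheme
    \<Rightarrow> ('k, 'a, 'h, 'q) lie_rinehart_alg_scheme \<Rightarrow> ('l \<Rightarrow> 'h) set"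
  where "lie_rinehart_hom K A L M =
    {f \<in> lie_hom K L M.
      (\<forall>a \<in> carrier A. \<forall>x \<in> carrier L. f (act L a x) = act M a (f x)) \<and>
      (\<forall>x \<in> carrier L. anchor M (f x) = anchor L x)}"

text \<open>The Lie-Rinehart algebra $\mathcal{A}_A^{A'}(L',\omega')$ for $\phi : A \to A'$.\<close>

definition anchored_pullback ::
  "('k, 'm) ring_scheme \<Rightarrow> ('k, 'a, 'n) module_scheme \<Rightarrow> ('a \<Rightarrow> 'b)
    \<Rightarrow> ('k, 'b, 'l, 'p) lie_rinehart_alg_scheme \<Rightarrow> ('k, 'a, 'l \<times> ('a \<Rightarrow> 'a)) lie_rinehart_alg"
  where "anchored_pullback K A \<phi> L' =
    \<lparr>carrier = {(x, d). x \<in> carrier L' \<and> d \<in> carrier (derivations K A) \<and>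
        (\<forall>a \<in> carrier A. anchor L' x (\<phi> a) = \<phi> (d a))},
      mult = undefined, one = undefined,
      zero = (\<zero>\<^bsub>L'\<^esub>, \<zero>\<^bsub>derivations K A\<^esub>),
      add = (\<lambda>(x, d) (y, e). (x \<oplus>\<^bsub>L'\<^esub> y, d \<oplus>\<^bsub>derivations K A\<^esub> e)),
      smult = (\<lambda>c (x, d). (c \<odot>\<^bsub>L'\<^esub> x, c \<odot>\<^bsub>derivations K A\<^esub> d)),
      bracket = (\<lambda>(x, d) (y, e). (bracket L' x y, bracket (derivations K A) d e)),
      act = (\<lambda>a (x, d). (act L' (\<phi> a) x, act (derivations K A) a d)),
      anchor = snd\<rparr>"

text \<open>
  The two notions of morphism between Lie-Rinehart algebras over different base algebras.
  A morphism is a function on the carrier, hence the components are taken extensional.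
\<close>

definition pullback_morphisms ::
  "('k, 'm) ring_scheme \<Rightarrow> ('k, 'a, 'n) module_scheme \<Rightarrow> ('k, 'a, 'l, 'p) lie_rinehart_alg_scheme
    \<Rightarrow> ('k, 'b, 'q) module_scheme \<Rightarrow> ('k, 'b, 'h, 'r) lie_rinehart_alg_scheme
    \<Rightarrow> (('a \<Rightarrow> 'b) \<times> ('l \<Rightarrow> 'h \<times> ('a \<Rightarrow> 'a))) set"
  where "pullback_morphisms K A L A' L' =
    {(\<phi>, \<Phi>). \<phi> \<in> alg_hom K A A' \<inter> extensional (carrier A) \<and>
      \<Phi> \<in> lie_rinehart_hom K A L (anchored_pullback K A \<phi> L') \<inter> extensional (carrier L)}"

definition huebschmann_morphisms ::
  "('k, 'm) ring_scheme \<Rightarrow> ('k, 'a, 'n) module_scheme \<Rightarrow> ('k, 'a, 'l, 'p) lie_rinehart_alg_scheme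
    \<Rightarrow> ('k, 'b, 'q) module_scheme \<Rightarrow> ('k, 'b, 'h, 'r) lie_rinehart_alg_scheme
    \<Rightarrow> (('a \<Rightarrow> 'b) \<times> ('l \<Rightarrow> 'h)) set"
  where "huebschmann_morphisms K A L A' L' =
    {(\<phi>, \<psi>). \<phi> \<in> alg_hom K A A' \<inter> extensional (carrier A) \<and>
      \<psi> \<in> lie_hom K L L' \<inter> extensional (carrier L) \<and>
      (\<forall>a \<in> carrier A. \<forall>x \<in> carrier L. \<psi> (act L a x) = act L' (\<phi> a) (\<psi> x)) \<and>
      (\<forall>a \<in> carrier A. \<forall>x \<in> carrier L. \<phi> (anchor L x a) = anchor L' (\<psi> x) (\<phi> a))}"

end

theory Submission
  imports Defs
begin

text \<open>
  The anchor of the pullback is the second projection, so compatibility with the anchors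
  forces the second component of \<open>\<Phi>\<close> to be \<open>\<omega>\<close>. What remains of \<open>\<Phi>\<close> is its first component
  \<open>\<psi>\<close>; the condition that \<open>(\<psi> X, \<omega> X)\<close> lies in the pullback is Huebschmann's compatibility
  of \<open>\<psi>\<close> with the anchors, and the operations on the pullback are component-wise.
\<close>

context lie_rinehart
begin

lemma act_closed: "\<lbrakk>a \<in> carrier A; x \<in> carrier L\<rbrakk> \<Longrightarrow> act L a x \<in> carrier L"
  using act.smult_closed[of a x] by (simp add: act_module_def)

lemma anchor_closed: "x \<in> carrier L \<Longrightarrow> anchor L x \<in> carrier (derivations K A)"
  using anchor_hom by (auto simp: lie_hom_def)

text \<open>Each clause for the pair splits into one for \<open>\<psi>\<close> and one for the
  anchor of \<open>L\<close>. The latter holds by \<open>anchor_closed\<close>,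
  \<open>anchor_hom\<close> or \<open>anchor_act\<close>, so nothing about \<open>\<phi>\<close>,
  \<open>\<psi>\<close> or \<open>L'\<close> has to be assumed.\<close>

lemma pair_lie_rinehart_hom_iff:
  "(\<lambda>x \<in> carrier L. (\<psi> x, anchor L x)) \<in> lie_rinehart_hom K A L (anchored_pullback K A \<phi> L') \<longleftrightarrow>
    \<psi> \<in> lie_hom K L L' \<and>
    (\<forall>a \<in> carrier A. \<forall>x \<in> carrier L. \<psi> (act L a x) = act L' (\<phi> a) (\<psi> x)) \<and>
    (\<forall>a \<in> carrier A. \<forall>x \<in> carrier L. \<phi> (anchor L x a) = anchor L' (\<psi> x) (\<phi> a))"
  (is "?pair \<in> _ \<longleftrightarrow> _")
proof -
  let ?P = "anchored_pullback K A \<phi> L'"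
  \<comment> \<open>The only clause that ties the two components together: membership in the
    pullback produces Huebschmann's condition.\<close>
  have carr: "?pair \<in> carrier L \<rightarrow> carrier ?P \<longleftrightarrow> \<psi> \<in> carrier L \<rightarrow> carrier L' \<and>
      (\<forall>a \<in> carrier A. \<forall>x \<in> carrier L. \<phi> (anchor L x a) = anchor L' (\<psi> x) (\<phi> a))"
    by (simp add: anchored_pullback_def Pi_iff anchor_closed ball_conj_distrib) metis
  have add: "?pair (x \<oplus>\<^bsub>L\<^esub> y) = ?pair x \<oplus>\<^bsub>?P\<^esub> ?pair y \<longleftrightarrow> \<psi> (x \<oplus>\<^bsub>L\<^esub> y) = \<psi> x \<oplus>\<^bsub>L'\<^esub> \<psi> y"
    if "x \<in> carrier L" "y \<in> carrier L" for x y
    using that anchor_hom by (simp add: anchored_pullback_def lie_hom_def)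
  have smult: "?pair (c \<odot>\<^bsub>L\<^esub> x) = c \<odot>\<^bsub>?P\<^esub> ?pair x \<longleftrightarrow> \<psi> (c \<odot>\<^bsub>L\<^esub> x) = c \<odot>\<^bsub>L'\<^esub> \<psi> x"
    if "c \<in> carrier K" "x \<in> carrier L" for c x
    using that anchor_hom by (simp add: anchored_pullback_def lie_hom_def)
  have bracket: "?pair (bracket L x y) = bracket ?P (?pair x) (?pair y) \<longleftrightarrow>
      \<psi> (bracket L x y) = bracket L' (\<psi> x) (\<psi> y)"
    if "x \<in> carrier L" "y \<in> carrier L" for x y
    using that anchor_hom by (simp add: anchored_pullback_def lie_hom_def L.bracket_closed)
  have act: "?pair (act L a x) = act ?P a (?pair x) \<longleftrightarrow> \<psi> (act L a x) = act L' (\<phi> a) (\<psi> x)"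
    if "a \<in> carrier A" "x \<in> carrier L" for a x
    using that by (simp add: anchored_pullback_def act_closed anchor_act)
  have anchor: "anchor ?P (?pair x) = anchor L x" if "x \<in> carrier L" for x
    using that by (simp add: anchored_pullback_def)
  show ?thesis
    unfolding lie_rinehart_hom_def lie_hom_def mem_Collect_eq carr
    \<comment> \<open>\<open>ball_cong\<close> supplies the carrier memberships under which the
      equivalences hold. The anchor clause becomes trivial; the remaining conjuncts differ only in
      order.\<close>
    by (simp only: add smult bracket act anchor ball_triv simp_thms cong: ball_cong) (simp only: conj_ac)
qed

text \<open>On \<open>carrier L\<close> the anchor condition fixes \<open>snd\<close>; off it both
  functions are \<open>undefined\<close>, by extensionality.\<close>

lemma lie_rinehart_hom_eq_pair:
  assumes "\<Phi> \<in> lie_rinehart_hom K A L (anchored_pullback K A \<phi> L')"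
    and "\<Phi> \<in> extensional (carrier L)"
  shows "\<Phi> = (\<lambda>x \<in> carrier L. (fst (\<Phi> x), anchor L x))"
proof (rule extensionalityI[OF assms(2) restrict_extensional])
  fix x assume "x \<in> carrier L"
  then have "snd (\<Phi> x) = anchor L x"
    using assms(1) by (simp add: lie_rinehart_hom_def anchored_pullback_def)
  with \<open>x \<in> carrier L\<close> show "\<Phi> x = (\<lambda>x \<in> carrier L. (fst (\<Phi> x), anchor L x)) x"
    by (simp add: prod_eq_iff)
qed

text \<open>Exhibits the morphisms of kind (i) as the image of those of kind (ii) under pairing with
  the anchor, the inverse map of the bijection.\<close>

lemma pullback_morphisms_iff:
  "(\<phi>, \<Phi>) \<in> pullback_morphisms K A L A' L' \<longleftrightarrow>
    (\<exists>\<psi>. (\<phi>, \<psi>) \<in> huebschmann_morphisms K A L A' L' \<and> \<Phi> = (\<lambda>x \<in> carrier L. (\<psi> x, anchor L x)))"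
proof
  assume "(\<phi>, \<Phi>) \<in> pullback_morphisms K A L A' L'"
  then have \<phi>: "\<phi> \<in> alg_hom K A A' \<inter> extensional (carrier A)"
    and \<Phi>: "\<Phi> \<in> lie_rinehart_hom K A L (anchored_pullback K A \<phi> L')" "\<Phi> \<in> extensional (carrier L)"
    by (auto simp: pullback_morphisms_def)
  \<comment> \<open>The restriction makes \<open>\<psi>\<close> extensional, as kind (ii)
    demands.\<close>
  define \<psi> where "\<psi> = (\<lambda>x \<in> carrier L. fst (\<Phi> x))"
  have eq: "\<Phi> = (\<lambda>x \<in> carrier L. (\<psi> x, anchor L x))"
    using lie_rinehart_hom_eq_pair[OF \<Phi>] by (simp add: \<psi>_def cong: restrict_cong)
  have "(\<lambda>x \<in> carrier L. (\<psi> x, anchor L x)) \<in> lie_rinehart_hom K A L (anchored_pullback K A \<phi> L')"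
    using \<Phi>(1) eq by (rule back_subst)
  moreover have "\<psi> \<in> extensional (carrier L)"
    by (simp add: \<psi>_def)
  ultimately have "(\<phi>, \<psi>) \<in> huebschmann_morphisms K A L A' L'"
    using \<phi> by (simp add: huebschmann_morphisms_def pair_lie_rinehart_hom_iff)
  with eq show "\<exists>\<psi>. (\<phi>, \<psi>) \<in> huebschmann_morphisms K A L A' L' \<and>
      \<Phi> = (\<lambda>x \<in> carrier L. (\<psi> x, anchor L x))"
    by blast
next
  assume "\<exists>\<psi>. (\<phi>, \<psi>) \<in> huebschmann_morphisms K A L A' L' \<and>
      \<Phi> = (\<lambda>x \<in> carrier L. (\<psi> x, anchor L x))"
  then show "(\<phi>, \<Phi>) \<in> pullback_morphisms K A L A' L'"
    by (auto simp: huebschmann_morphisms_def pullback_morphisms_def pair_lie_rinehart_hom_iff)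
qed

end

theorem proposition4p4:
  fixes K :: "('k, 'm) ring_scheme"
    and A :: "('k, 'a, 'n) module_scheme"
    and L :: "('k, 'a, 'l, 'p) lie_rinehart_alg_scheme"
    and A' :: "('k, 'b, 'q) module_scheme"
    and L' :: "('k, 'b, 'h, 'r) lie_rinehart_alg_scheme"
  assumes "field_char0 K"
    and "lie_rinehart K A L"
    and "lie_rinehart K A' L'"
  shows "bij_betw (\<lambda>(\<phi>, \<Phi>). (\<phi>, \<lambda>x \<in> carrier L. fst (\<Phi> x)))
           (pullback_morphisms K A L A' L') (huebschmann_morphisms K A L A' L')"
proof -
  interpret lie_rinehart K A L by fact
  let ?f = "\<lambda>(\<phi> :: 'a \<Rightarrow> 'b, \<Phi> :: 'l \<Rightarrow> 'h \<times> ('a \<Rightarrow> 'a)). (\<phi>, \<lambda>x \<in> carrier L. fst (\<Phi> x))"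
  let ?g = "\<lambda>(\<phi> :: 'a \<Rightarrow> 'b, \<psi> :: 'l \<Rightarrow> 'h). (\<phi>, \<lambda>x \<in> carrier L. (\<psi> x, anchor L x))"
  \<comment> \<open>The result is \<open>\<psi>\<close> restricted to \<open>carrier L\<close>,
    which is \<open>\<psi>\<close> itself by extensionality.\<close>
  have f_g: "?f (?g p) = p" if "p \<in> huebschmann_morphisms K A L A' L'" for p
    using that by (auto simp: huebschmann_morphisms_def extensional_restrict cong: restrict_cong)
  have pullback: "pullback_morphisms K A L A' L' = ?g ` huebschmann_morphisms K A L A' L'"
    by (rule Set.set_eqI) (clarsimp simp: pullback_morphisms_iff image_iff Bex_def)
  show ?thesis
    unfolding pullback
    \<comment> \<open>Since the domain is the image of \<open>?g\<close>, the other inverse law also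
      follows from \<open>f_g\<close>: \<open>?g (?f (?g p)) = ?g p\<close>.\<close>
    by (rule bij_betw_byWitness[where f' = ?g]) (simp_all add: f_g image_image)
qed

end
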